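(* Let $\{x_i\}_{i=1}^m$ be a regular two-distance set in $\mathbb{R}^n$ at angles $\alpha,\beta$ with Grammian constant $c>0$. If $\alpha+\beta\le 2c/m$, then there exist $m$ equiangular lines in $\mathbb{R}^n$.
   Context: A spherical two-distance set in $\mathbb{R}^n$ at angles $\alpha$ and $\beta$ is a set of unit vectors $\{x_i\}_{i=1}^m$ in $\mathbb{R}^n$ for which there are two real numbers $\alpha\neq\beta$, $-1\le\alpha,\beta\le 1$, such that $\langle x_i,x_j\rangle$ is either $\alpha$ or $\beta$ for all $i\neq j$. It is called regular (a regular two-distance set) if the number of indices $j\neq i$ with $\langle x_i,x_j\rangle=\alpha$ (and hence the number with $\langle x_i,x_j\rangle=\beta$) does not depend on $i$. The Grammian constant of a regular two-distance set is the common row sum $c=\sum_{j=1}^m\langle x_i,x_j\rangle$ of its Gram matrix. A set of lines in Euclidean space is called equiangular if the angle between each pair of lines is the same; in other words, choosing a unit vector spanning each line gives a spherical two-distance set at angles $\{a,-a\}$ for some $a\in[0,1)$. *)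

theory Defs
  imports "HOL-Analysis.Analysis"
begin

(* The points are x 1, ..., x m. Injectivity expresses that they form a set of m vectors.
   The two values need not both occur. *)
definition spherical_two_distance_set ::
    "nat \<Rightarrow> (nat \<Rightarrow> 'a::euclidean_space) \<Rightarrow> real \<Rightarrow> real \<Rightarrow> bool" where
  "spherical_two_distance_set m x \<alpha> \<beta> \<longleftrightarrow>
     inj_on x {1..m} \<and> (\<forall>i\<in>{1..m}. norm (x i) = 1) \<and>
     \<alpha> \<noteq> \<beta> \<and> -1 \<le> \<alpha> \<and> \<alpha> \<le> 1 \<and> -1 \<le> \<beta> \<and> \<beta> \<le> 1 \<and>
     (\<forall>i\<in>{1..m}. \<forall>j\<in>{1..m}. i \<noteq> j \<longrightarrow> x i \<bullet> x j = \<alpha> \<or> x i \<bullet> x j = \<beta>)"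

definition regular_two_distance_set ::
    "nat \<Rightarrow> (nat \<Rightarrow> 'a::euclidean_space) \<Rightarrow> real \<Rightarrow> real \<Rightarrow> bool" where
  "regular_two_distance_set m x \<alpha> \<beta> \<longleftrightarrow>
     spherical_two_distance_set m x \<alpha> \<beta> \<and>
     (\<exists>k. \<forall>i\<in>{1..m}. card {j\<in>{1..m}. j \<noteq> i \<and> x i \<bullet> x j = \<alpha>} = k)"

definition has_grammian_constant ::
    "nat \<Rightarrow> (nat \<Rightarrow> 'a::euclidean_space) \<Rightarrow> real \<Rightarrow> bool" where
  "has_grammian_constant m x c \<longleftrightarrow> (\<forall>i\<in>{1..m}. (\<Sum>j=1..m. x i \<bullet> x j) = c)"

definition is_line :: "'a::euclidean_space set \<Rightarrow> bool" where
  "is_line L \<longleftrightarrow> subspace L \<and> dim L = 1"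

(* The angle between two lines is the non-obtuse one; it does not depend on the choice of
   the unit vectors u and v, which are determined up to sign. *)
definition lines_at_angle ::
    "real \<Rightarrow> 'a::euclidean_space set \<Rightarrow> 'a set \<Rightarrow> bool" where
  "lines_at_angle \<theta> L M \<longleftrightarrow>
     (\<forall>u\<in>L. \<forall>v\<in>M. norm u = 1 \<longrightarrow> norm v = 1 \<longrightarrow> arccos \<bar>u \<bullet> v\<bar> = \<theta>)"

definition equiangular_lines :: "'a::euclidean_space set set \<Rightarrow> bool" where
  "equiangular_lines A \<longleftrightarrow>
     (\<forall>L\<in>A. is_line L) \<and>
     (\<exists>\<theta>. \<forall>L\<in>A. \<forall>M\<in>A. L \<noteq> M \<longrightarrow> lines_at_angle \<theta> L M)"

lemma is_line_unit_vector:
  assumes "is_line L" obtains u where "u \<in> L" "norm u = 1"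
proof -
  from assms have L: "subspace L" "dim L = 1" by (auto simp: is_line_def)
  then have "\<not> L \<subseteq> {0}" using dim_eq_0[of L] by simp
  then obtain w where w: "w \<in> L" "w \<noteq> 0" by auto
  show ?thesis
  proof
    show "(1 / norm w) *\<^sub>R w \<in> L" using L(1) w(1) by (rule subspace_scale)
    show "norm ((1 / norm w) *\<^sub>R w) = 1" using w(2) by simp
  qed
qed

lemma is_line_span:
  assumes "is_line L" "u \<in> L" "u \<noteq> 0" shows "L = span {u}"
proof -
  have "span {u} = span L"
    using assms by (intro dim_eq_span) (auto simp: is_line_def)
  then show ?thesis using assms(1) span_eq_iff[of L] unfolding is_line_def by blast
qed

lemma is_line_inner_less_1:
  assumes "is_line L" "is_line M" "L \<noteq> M" "u \<in> L" "v \<in> M" "norm u = 1" "norm v = 1"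
  shows "\<bar>u \<bullet> v\<bar> < 1"
proof -
  have "\<bar>u \<bullet> v\<bar> \<le> 1" using Cauchy_Schwarz_ineq2[of u v] assms by simp
  moreover have "\<bar>u \<bullet> v\<bar> \<noteq> 1"
  proof
    assume "\<bar>u \<bullet> v\<bar> = 1"
    then have "u = v \<or> u = - v"
      using norm_cauchy_schwarz_abs_eq[of u v] assms(6,7) by auto
    then have "u \<in> M" using assms(2,5) by (auto simp: is_line_def subspace_neg)
    moreover have "u \<noteq> 0" using assms(6) by auto
    ultimately have "L = M" using is_line_span assms(1,2,4) by metis
    then show False using assms(3) by simp
  qed
  ultimately show ?thesis by simp
qed

lemma equiangular_lines_iff:
  fixes A :: "'a::euclidean_space set set"
  shows "equiangular_lines A \<longleftrightarrow>
     (\<forall>L\<in>A. is_line L) \<and>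
     (\<exists>a. 0 \<le> a \<and> a < 1 \<and> (\<forall>L\<in>A. \<forall>M\<in>A. L \<noteq> M \<longrightarrow>
        (\<forall>u\<in>L. \<forall>v\<in>M. norm u = 1 \<longrightarrow> norm v = 1 \<longrightarrow> u \<bullet> v = a \<or> u \<bullet> v = -a)))"
    (is "_ \<longleftrightarrow> ?lines \<and> (\<exists>a. ?P a)")
proof (cases ?lines)
  case False
  then show ?thesis unfolding equiangular_lines_def by blast
next
  case lines: True
  have "(\<exists>\<theta>. \<forall>L\<in>A. \<forall>M\<in>A. L \<noteq> M \<longrightarrow> lines_at_angle \<theta> L M) \<longleftrightarrow> (\<exists>a. ?P a)"
  proof
    assume "\<exists>\<theta>. \<forall>L\<in>A. \<forall>M\<in>A. L \<noteq> M \<longrightarrow> lines_at_angle \<theta> L M"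
    then obtain \<theta> where \<theta>: "\<And>L M. L \<in> A \<Longrightarrow> M \<in> A \<Longrightarrow> L \<noteq> M \<Longrightarrow> lines_at_angle \<theta> L M"
      by blast
    show "\<exists>a. ?P a"
    proof (cases "\<exists>L\<in>A. \<exists>M\<in>A. L \<noteq> M")
      case False
      then show ?thesis by (intro exI[of _ 0]) auto
    next
      case True
      have eq: "\<bar>u \<bullet> v\<bar> = cos \<theta>" and lt: "\<bar>u \<bullet> v\<bar> < 1"
        if "L \<in> A" "M \<in> A" "L \<noteq> M" "u \<in> L" "v \<in> M" "norm u = 1" "norm v = 1" for L M u v
      proof -
        show lt: "\<bar>u \<bullet> v\<bar> < 1" using is_line_inner_less_1 lines that by blast
        have "arccos \<bar>u \<bullet> v\<bar> = \<theta>" using \<theta>[OF that(1-3)] that by (auto simp: lines_at_angle_def)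
        then show "\<bar>u \<bullet> v\<bar> = cos \<theta>" using lt cos_arccos_abs[of "\<bar>u \<bullet> v\<bar>"] by auto
      qed
      from True obtain L M where LM: "L \<in> A" "M \<in> A" "L \<noteq> M" by blast
      obtain u v where uv: "u \<in> L" "norm u = 1" "v \<in> M" "norm v = 1"
        using is_line_unit_vector lines LM by metis
      have "0 \<le> cos \<theta>" "cos \<theta> < 1"
        using eq[OF LM uv(1,3,2,4)] lt[OF LM uv(1,3,2,4)] by linarith+
      moreover have "u \<bullet> v = cos \<theta> \<or> u \<bullet> v = - cos \<theta>"
        if "L \<in> A" "M \<in> A" "L \<noteq> M" "u \<in> L" "v \<in> M" "norm u = 1" "norm v = 1" for L M u v
        using eq[OF that] by linarith
      ultimately show ?thesis by blast
    qed
  next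
    assume "\<exists>a. ?P a"
    then obtain a where "?P a" by blast
    then have "\<forall>L\<in>A. \<forall>M\<in>A. L \<noteq> M \<longrightarrow> lines_at_angle (arccos a) L M"
      unfolding lines_at_angle_def by (metis abs_minus_cancel abs_of_nonneg)
    then show "\<exists>\<theta>. \<forall>L\<in>A. \<forall>M\<in>A. L \<noteq> M \<longrightarrow> lines_at_angle \<theta> L M" by blast
  qed
  then show ?thesis using lines by (simp add: equiangular_lines_def)
qed

end

theory Submission
  imports Defs
begin

text \<open>
  Let \<open>S\<close> be the sum of all \<open>x i\<close>, so that \<open>S \<bullet> x i = c\<close> and \<open>S \<bullet> S = m c\<close>. Replacing every
  \<open>x i\<close> by \<open>x i - t S\<close> lowers all inner products by the same number \<open>2 c t - m c t\<^sup>2\<close>, whose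
  maximum over \<open>t\<close> is \<open>c / m\<close>. The hypothesis on \<open>\<alpha> + \<beta>\<close> therefore provides a \<open>t\<close> for which this
  number is \<open>(\<alpha> + \<beta>) / 2\<close>, and the new inner products are \<open>\<plusminus>(\<alpha> - \<beta>) / 2\<close>. The lines spanned by
  the new vectors are distinct unless \<open>\<alpha>\<close> or \<open>\<beta>\<close> is \<open>1\<close>; such a value cannot occur between
  distinct unit vectors, so then the \<open>x i\<close> themselves have a single mutual inner product.
\<close>

text \<open>The bound \<open>a < r\<^sup>2\<close> is strict Cauchy-Schwarz: no two of the vectors
  are parallel, so the spans are distinct. Unit vectors on these lines are the \<open>y i\<close>
  scaled by 1 / \<open>r\<close> up to sign, hence the common angle
  \<open>arccos (a / r\<^sup>2)\<close>.\<close>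

lemma equiangular_lines_spans:
  fixes y :: "'i \<Rightarrow> 'a::euclidean_space"
  assumes "0 < r"
    and norm: "\<And>i. i \<in> I \<Longrightarrow> norm (y i) = r"
    and inner: "\<And>i j. i \<in> I \<Longrightarrow> j \<in> I \<Longrightarrow> i \<noteq> j \<Longrightarrow> \<bar>y i \<bullet> y j\<bar> = a"
    and "a < r\<^sup>2"
  shows "inj_on (\<lambda>i. span {y i}) I" and "equiangular_lines ((\<lambda>i. span {y i}) ` I)"
proof -
  show "inj_on (\<lambda>i. span {y i}) I"
  proof (intro inj_onI, rule ccontr)
    fix i j assume ij: "i \<in> I" "j \<in> I" "span {y i} = span {y j}" "i \<noteq> j"
    then have "y i \<in> span {y j}" by (metis span_base singletonI)
    then obtain k where k: "y i = k *\<^sub>R y j" by (auto simp: span_singleton)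
    \<comment> \<open>Parallel vectors attain equality in Cauchy-Schwarz, which would force
      \<open>a = r\<^sup>2\<close>.\<close>
    then have "\<bar>y i \<bullet> y j\<bar> = norm (y i) * norm (y j)"
      by (simp add: abs_mult flip: power2_norm_eq_inner power2_eq_square)
    then show False using inner[OF ij(1,2,4)] norm ij \<open>a < r\<^sup>2\<close> by (simp add: power2_eq_square)
  qed
  have line: "is_line (span {y i})" if "i \<in> I" for i
  proof -
    have "y i \<noteq> 0" using norm[OF that] \<open>0 < r\<close> by auto
    then show ?thesis by (simp add: is_line_def dim_singleton)
  qed
  have "lines_at_angle (arccos (a / r\<^sup>2)) (span {y i}) (span {y j})"
    if ij: "i \<in> I" "j \<in> I" "i \<noteq> j" for i j
    unfolding lines_at_angle_def
  proof (intro ballI impI)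
    fix u v assume uv: "u \<in> span {y i}" "v \<in> span {y j}" "norm u = 1" "norm v = 1"
    then obtain k l where kl: "u = k *\<^sub>R y i" "v = l *\<^sub>R y j" by (auto simp: span_singleton)
    then have "\<bar>k\<bar> = 1 / r" "\<bar>l\<bar> = 1 / r"
      using uv norm ij \<open>0 < r\<close> by (auto simp: field_simps)
    then have "\<bar>u \<bullet> v\<bar> = a / r\<^sup>2"
      using inner[OF ij] by (simp add: kl abs_mult power2_eq_square)
    then show "arccos \<bar>u \<bullet> v\<bar> = arccos (a / r\<^sup>2)" by simp
  qed
  then have "\<exists>\<theta>. \<forall>L\<in>(\<lambda>i. span {y i}) ` I. \<forall>M\<in>(\<lambda>i. span {y i}) ` I.
      L \<noteq> M \<longrightarrow> lines_at_angle \<theta> L M"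
    by blast
  then show "equiangular_lines ((\<lambda>i. span {y i}) ` I)"
    using line by (auto simp: equiangular_lines_def)
qed

lemma exists_equiangular_lines:
  fixes y :: "'i \<Rightarrow> 'a::euclidean_space"
  assumes "finite I" "0 < r"
    and "\<And>i. i \<in> I \<Longrightarrow> norm (y i) = r"
    and "\<And>i j. i \<in> I \<Longrightarrow> j \<in> I \<Longrightarrow> i \<noteq> j \<Longrightarrow> \<bar>y i \<bullet> y j\<bar> = a"
    and "a < r\<^sup>2"
  shows "\<exists>A :: 'a set set. finite A \<and> card A = card I \<and> equiangular_lines A"
  using equiangular_lines_spans[of r I y a] assms
  by (intro exI[of _ "(\<lambda>i. span {y i}) ` I"]) (simp add: card_image)

lemma inner_eq_1_imp_eq:
  fixes u v :: "'a::real_inner"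
  assumes "norm u = 1" "norm v = 1" "u \<bullet> v = 1"
  shows "u = v"
  using assms norm_cauchy_schwarz_eq[of u v] by simp

text \<open>Serves the case in which one of the two values is 1. For two or more vectors, a positive
  row sum keeps \<gamma> above -1, so the given vectors already span distinct lines.\<close>

lemma exists_equiangular_lines_simplex:
  fixes x :: "'i \<Rightarrow> 'a::euclidean_space"
  assumes "finite I"
    and norm: "\<And>i. i \<in> I \<Longrightarrow> norm (x i) = 1"
    and inner: "\<And>i j. i \<in> I \<Longrightarrow> j \<in> I \<Longrightarrow> i \<noteq> j \<Longrightarrow> x i \<bullet> x j = \<gamma>"
    and "\<gamma> < 1"
    and sum: "\<And>i. i \<in> I \<Longrightarrow> 0 < (\<Sum>j\<in>I. x i \<bullet> x j)"
  shows "\<exists>A :: 'a set set. finite A \<and> card A = card I \<and> equiangular_lines A"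
proof (cases "card I \<le> 1")
  case True
  then have "i = j" if "i \<in> I" "j \<in> I" for i j
    using that \<open>finite I\<close> card_le_Suc0_iff_eq by auto
  \<comment> \<open>There are no pairs here and \<gamma> has no lower bound, so the value 0 stands
    in for its modulus.\<close>
  then show ?thesis
    by (intro exists_equiangular_lines[of I 1 x 0]) (use assms in auto)
next
  case False
  then obtain i where i: "i \<in> I" by fastforce
  have "(\<Sum>j\<in>I. x i \<bullet> x j) = x i \<bullet> x i + (\<Sum>j\<in>I - {i}. x i \<bullet> x j)"
    using i \<open>finite I\<close> by (simp add: sum.remove)
  also have "(\<Sum>j\<in>I - {i}. x i \<bullet> x j) = (\<Sum>j\<in>I - {i}. \<gamma>)"
    using i inner by (intro sum.cong) auto
  finally have "0 < 1 + real (card I - 1) * \<gamma>"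
    using sum[OF i] norm[OF i] i \<open>finite I\<close> by (simp add: norm_eq_1)
  moreover have "real (card I - 1) * \<gamma> \<le> -1" if "\<gamma> \<le> -1"
    using mult_mono[of 1 "real (card I - 1)" 1 "-\<gamma>"] that False by simp
  ultimately have "-1 < \<gamma>" by force
  then have "\<bar>\<gamma>\<bar> < 1" using \<open>\<gamma> < 1\<close> by simp
  then show ?thesis
    by (intro exists_equiangular_lines[of I 1 x "\<bar>\<gamma>\<bar>"]) (use assms in auto)
qed

lemma inner_diff_scaled_sum:
  fixes x :: "'i \<Rightarrow> 'a::real_inner"
  assumes sum: "\<And>i. i \<in> I \<Longrightarrow> (\<Sum>j\<in>I. x i \<bullet> x j) = c"
    and "i \<in> I" "j \<in> I"
  shows "(x i - t *\<^sub>R sum x I) \<bullet> (x j - t *\<^sub>R sum x I)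
    = x i \<bullet> x j - (2 * c * t - real (card I) * c * t\<^sup>2)"
proof -
  have row: "x i \<bullet> sum x I = c" if "i \<in> I" for i
    using sum[OF that] by (simp add: inner_sum_right)
  have "sum x I \<bullet> sum x I = real (card I) * c"
    by (simp add: inner_sum_left[of x I "sum x I"] row)
  then show ?thesis
    using row[of i] row[of j] assms
    by (simp add: inner_commute[of "sum x I" "x j"] algebra_simps power2_eq_square)
qed

text \<open>Completing the square turns the left-hand side into
  \<open>c / m * (1 - (1 - m * t)\<^sup>2)\<close>. Solving for \<open>1 - m * t\<close> gives the
  square root \<open>d\<close>, which is real because \<open>s \<le> c / m\<close>.\<close>

lemma quadratic_attains_below_max:
  fixes c m s :: real
  assumes "0 < c" "0 < m" "s \<le> c / m"
  shows "\<exists>t. 2 * c * t - m * c * t\<^sup>2 = s"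
proof -
  define d where "d = sqrt (1 - m * s / c)"
  have "m * s / c \<le> 1" using assms by (simp add: field_simps)
  then have "d\<^sup>2 = 1 - m * s / c" by (simp add: d_def)
  moreover have "2 * c * ((1 - d) / m) - m * c * ((1 - d) / m)\<^sup>2 = c / m * (1 - d\<^sup>2)"
    using assms by (simp add: field_simps power2_eq_square)
  ultimately have "2 * c * ((1 - d) / m) - m * c * ((1 - d) / m)\<^sup>2 = s"
    using assms by simp
  then show ?thesis by blast
qed

theorem proposition4p3:
  fixes x :: "nat \<Rightarrow> real ^ 'n" and m :: nat and \<alpha> \<beta> c :: real
  assumes "regular_two_distance_set m x \<alpha> \<beta>"
    and "has_grammian_constant m x c"
    and "c > 0"
    and "\<alpha> + \<beta> \<le> 2 * c / real m"
  shows "\<exists>A :: (real ^ 'n) set set. finite A \<and> card A = m \<and> equiangular_lines A"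
proof -
  have inj: "inj_on x {1..m}"
    and norm: "\<And>i. i \<in> {1..m} \<Longrightarrow> norm (x i) = 1"
    and angles: "\<alpha> \<noteq> \<beta>" "\<alpha> \<le> 1" "\<beta> \<le> 1"
    and inner: "\<And>i j. i \<in> {1..m} \<Longrightarrow> j \<in> {1..m} \<Longrightarrow> i \<noteq> j \<Longrightarrow> x i \<bullet> x j = \<alpha> \<or> x i \<bullet> x j = \<beta>"
    using assms(1)
    unfolding regular_two_distance_set_def spherical_two_distance_set_def by auto
  have sum: "\<And>i. i \<in> {1..m} \<Longrightarrow> (\<Sum>j=1..m. x i \<bullet> x j) = c"
    using assms(2) by (simp add: has_grammian_constant_def)
  have not1: "x i \<bullet> x j \<noteq> 1" if "i \<in> {1..m}" "j \<in> {1..m}" "i \<noteq> j" for i j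
    using inner_eq_1_imp_eq norm inj that by (metis inj_onD)
  \<comment> \<open>If the larger of \<alpha> and \<beta> is 1, the shifted vectors would meet
    Cauchy-Schwarz with equality and could span the same line, so these cases are split off.\<close>
  consider "m = 0" | "\<alpha> = 1" | "\<beta> = 1" | "0 < m" "\<alpha> < 1" "\<beta> < 1"
    using angles by fastforce
  then show ?thesis
  proof cases
    case 1
    then show ?thesis by (intro exI[of _ "{}"]) (simp add: equiangular_lines_def)
  next
    case 2
    have "x i \<bullet> x j = \<beta>" if "i \<in> {1..m}" "j \<in> {1..m}" "i \<noteq> j" for i j
      using inner[OF that] not1[OF that] 2 by auto
    then show ?thesis
      using exists_equiangular_lines_simplex[of "{1..m}" x \<beta>] norm sum angles 2 \<open>c > 0\<close> by simp
  next
    case 3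
    have "x i \<bullet> x j = \<alpha>" if "i \<in> {1..m}" "j \<in> {1..m}" "i \<noteq> j" for i j
      using inner[OF that] not1[OF that] 3 by auto
    then show ?thesis
      using exists_equiangular_lines_simplex[of "{1..m}" x \<alpha>] norm sum angles 3 \<open>c > 0\<close> by simp
  next
    case 4
    have "(\<alpha> + \<beta>) / 2 \<le> c / real m" using assms(4) by (simp add: mult.commute)
    then obtain t where t: "2 * c * t - real m * c * t\<^sup>2 = (\<alpha> + \<beta>) / 2"
      using quadratic_attains_below_max[OF \<open>c > 0\<close>, of "real m"] 4 by (metis of_nat_0_less_iff)
    define y where "y i = x i - t *\<^sub>R sum x {1..m}" for i
    \<comment> \<open>The case \<open>i = j\<close> is included and yields the common norm of the
      \<open>y i\<close>.\<close>
    have y: "y i \<bullet> y j = x i \<bullet> x j - (\<alpha> + \<beta>) / 2" if "i \<in> {1..m}" "j \<in> {1..m}" for i j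
      using inner_diff_scaled_sum[OF sum that, of t] t by (simp add: y_def)
    have norm_y: "norm (y i) = sqrt (1 - (\<alpha> + \<beta>) / 2)" if "i \<in> {1..m}" for i
      using y[OF that that] norm[OF that] by (simp add: norm_eq_sqrt_inner)
    have inner_y: "\<bar>y i \<bullet> y j\<bar> = \<bar>\<alpha> - \<beta>\<bar> / 2"
      if "i \<in> {1..m}" "j \<in> {1..m}" "i \<noteq> j" for i j
      using inner[OF that] y[OF that(1,2)] by (auto simp: abs_if field_simps)
    \<comment> \<open>The right side minus the left side is 1 minus the larger of \<alpha> and
      \<beta>.\<close>
    have "\<bar>\<alpha> - \<beta>\<bar> / 2 < (sqrt (1 - (\<alpha> + \<beta>) / 2))\<^sup>2"
      using 4 by (simp add: abs_if field_simps)
    moreover have "0 < sqrt (1 - (\<alpha> + \<beta>) / 2)"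
      using 4 by simp
    ultimately show ?thesis
      using exists_equiangular_lines[of "{1..m}", OF _ _ norm_y inner_y] by simp
  qed
qed

end
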